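(* Let $\mathcal{A},\mathcal{B}\in\mathbb{C}^{\mathbf{N}(n)\times\mathbf{N}(n)}$ with $\mathrm{ind}(\mathcal{A})=1$. Then $\mathcal{A}^{\mathrm{core}}=\mathcal{B}*_n(\mathcal{A}*_n\mathcal{B})^{\mathrm{core}}$ if and only if $\mathscr{R}(\mathcal{A})\subseteq\mathscr{R}(\mathcal{B}*_n\mathcal{A}*_n\mathcal{B})$.
   Context: Here $\mathbf{N}(n)=N_1\times\cdots\times N_n$ and $\mathbb{C}^{\mathbf{N}(n)\times\mathbf{N}(n)}$ is the set of complex tensors $\mathcal{A}=(a_{i_1\ldots i_n j_1\ldots j_n})$ with $1\le i_k,j_k\le N_k$. The Einstein product is $(\mathcal{A}*_n\mathcal{B})_{i_1\ldots i_n j_1\ldots j_n}=\sum_{k_1,\ldots,k_n}a_{i_1\ldots i_n k_1\ldots k_n}b_{k_1\ldots k_n j_1\ldots j_n}$ (and similarly $\mathcal{A}*_n\mathcal{X}\in\mathbb{C}^{\mathbf{N}(n)}$ for $\mathcal{X}\in\mathbb{C}^{\mathbf{N}(n)}$), powers are taken with respect to $*_n$, and $\mathcal{A}^*$ is the conjugate transpose (swap the first $n$ and last $n$ indices and conjugate). The range is $\mathscr{R}(\mathcal{A})=\{\mathcal{A}*_n\mathcal{X}:\mathcal{X}\in\mathbb{C}^{\mathbf{N}(n)}\}$. The index $\mathrm{ind}(\mathcal{A})$ is the smallest positive integer $k$ with $\mathscr{R}(\mathcal{A}^k)=\mathscr{R}(\mathcal{A}^{k+1})$. The core inverse $\mathcal{A}^{\mathrm{core}}$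 is the tensor $\mathcal{X}$ (unique when it exists; it exists when $\mathrm{ind}(\mathcal{A})=1$) with $(\mathcal{A}*_n\mathcal{X})^*=\mathcal{A}*_n\mathcal{X}$, $\mathcal{X}*_n\mathcal{A}^2=\mathcal{A}$, $\mathcal{A}*_n\mathcal{X}^2=\mathcal{X}$. An equality involving a core inverse is understood to include its existence. *)

theory Defs
  imports Complex_Main "HOL-Library.FuncSet"
begin

text \<open>
  The list \<open>N = [N\<^sub>1, \<dots>, N\<^sub>n]\<close> carries the dimensions, so \<open>n = length N\<close>.  A multi-index
  \<open>(i\<^sub>1, \<dots>, i\<^sub>n)\<close> is a list, and a tensor is an extensional function on (pairs of) multi-indices:
  two tensors in a carrier set are equal as functions iff all their entries agree.
\<close>

type_synonym multi_index = "nat list"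
type_synonym vec_tensor = "multi_index \<Rightarrow> complex"
type_synonym sq_tensor = "multi_index \<times> multi_index \<Rightarrow> complex"

definition multi_indices :: "nat list \<Rightarrow> multi_index set" where
  "multi_indices N = {i. length i = length N \<and> (\<forall>k<length N. 1 \<le> i ! k \<and> i ! k \<le> N ! k)}"

definition vec_tensors :: "nat list \<Rightarrow> vec_tensor set" where
  "vec_tensors N = (multi_indices N \<rightarrow>\<^sub>E UNIV)"

definition sq_tensors :: "nat list \<Rightarrow> sq_tensor set" where
  "sq_tensors N = (multi_indices N \<times> multi_indices N \<rightarrow>\<^sub>E UNIV)"

definition einstein_prod :: "sq_tensor \<Rightarrow> nat list \<Rightarrow> sq_tensor \<Rightarrow> sq_tensor"
    (\<open>(_ \<star>\<^bsub>_\<^esub>/ _)\<close> [70, 0, 71] 70) where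
  "A \<star>\<^bsub>N\<^esub> B = (\<lambda>(i, j) \<in> multi_indices N \<times> multi_indices N.
     \<Sum>k \<in> multi_indices N. A (i, k) * B (k, j))"

definition einstein_apply :: "sq_tensor \<Rightarrow> nat list \<Rightarrow> vec_tensor \<Rightarrow> vec_tensor"
    (\<open>(_ \<star>v\<^bsub>_\<^esub>/ _)\<close> [70, 0, 71] 70) where
  "A \<star>v\<^bsub>N\<^esub> X = (\<lambda>i \<in> multi_indices N. \<Sum>k \<in> multi_indices N. A (i, k) * X k)"

definition unit_tensor :: "nat list \<Rightarrow> sq_tensor" where
  "unit_tensor N = (\<lambda>(i, j) \<in> multi_indices N \<times> multi_indices N. if i = j then 1 else 0)"

primrec tensor_pow :: "nat list \<Rightarrow> sq_tensor \<Rightarrow> nat \<Rightarrow> sq_tensor" where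
  "tensor_pow N A 0 = unit_tensor N"
| "tensor_pow N A (Suc k) = tensor_pow N A k \<star>\<^bsub>N\<^esub> A"

definition conj_transpose :: "nat list \<Rightarrow> sq_tensor \<Rightarrow> sq_tensor" where
  "conj_transpose N A = (\<lambda>(i, j) \<in> multi_indices N \<times> multi_indices N. cnj (A (j, i)))"

definition tensor_range :: "nat list \<Rightarrow> sq_tensor \<Rightarrow> vec_tensor set" where
  "tensor_range N A = {A \<star>v\<^bsub>N\<^esub> X | X. X \<in> vec_tensors N}"

text \<open>The index ranges over positive exponents only, so an invertible tensor has index 1.\<close>

definition tensor_index :: "nat list \<Rightarrow> sq_tensor \<Rightarrow> nat" where
  "tensor_index N A = (LEAST k. 0 < k \<and>
     tensor_range N (tensor_pow N A k) = tensor_range N (tensor_pow N A (k + 1)))"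

definition is_core_inverse :: "nat list \<Rightarrow> sq_tensor \<Rightarrow> sq_tensor \<Rightarrow> bool" where
  "is_core_inverse N A X \<longleftrightarrow> X \<in> sq_tensors N \<and>
     conj_transpose N (A \<star>\<^bsub>N\<^esub> X) = A \<star>\<^bsub>N\<^esub> X \<and>
     X \<star>\<^bsub>N\<^esub> tensor_pow N A 2 = A \<and>
     A \<star>\<^bsub>N\<^esub> tensor_pow N X 2 = X"

definition has_core_inverse :: "nat list \<Rightarrow> sq_tensor \<Rightarrow> bool" where
  "has_core_inverse N A \<longleftrightarrow> (\<exists>X. is_core_inverse N A X)"

text \<open>Meaningful only under \<^const>\<open>has_core_inverse\<close>; the core inverse is then unique.\<close>

definition core_inverse :: "nat list \<Rightarrow> sq_tensor \<Rightarrow> sq_tensor" where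
  "core_inverse N A = (THE X. is_core_inverse N A X)"

end

theory Submission
  imports Defs
begin

text \<open>
  Inclusion of ranges is left divisibility: \<open>R(A) \<subseteq> R(M)\<close> iff \<open>A = M W\<close> for some \<open>W\<close>
  (\<open>tensor_range_subset_iff\<close>).  With this, the whole argument is equational in the associative algebra
  of square tensors.  Two properties of the algebra matter: its involution is proper, that is,
  \<open>A\<^sup>* A X = A\<^sup>* A Y\<close> implies \<open>A X = A Y\<close> (\<open>conj_transpose_cancel\<close>), and every \<open>M\<close> satisfies
  \<open>M\<^sup>k = M\<^sup>k\<^sup>+\<^sup>1 C\<close> for some \<open>k\<close> and some \<open>C\<close> that commutes with \<open>M\<close>, because the powers of \<open>M\<close> are
  linearly dependent (\<open>strongly_pi_regular\<close>).

  Index 1 means \<open>A = A\<^sup>2 V\<close>.  Then \<open>A = C A\<^sup>2\<close> with \<open>C\<close> commuting with \<open>A\<close>; together with an inner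
  inverse \<open>Y\<close> for which \<open>A Y\<close> is self-adjoint, \<open>C A Y\<close> is a core inverse of \<open>A\<close>
  (\<open>square_divides_imp_core_inverse\<close>).

  If \<open>B Y\<close> is the core inverse of \<open>A\<close>, with \<open>Y\<close> that of \<open>A B\<close>, then \<open>A = B Y A\<^sup>2\<close> and \<open>Y = A B Y\<^sup>2\<close> give
  \<open>A = B A B Y\<^sup>2 A\<^sup>2\<close>.  Conversely, let \<open>A = B A B W\<close> and \<open>D = A B\<close>.  From \<open>A = A\<^sup>2 V\<close> one gets
  \<open>A = D\<^sup>2 W V\<close>, so \<open>A\<close>, \<open>D\<close> and \<open>D\<^sup>2\<close> have the same range, and \<open>D\<close> has a core inverse \<open>Y\<close>.  Now
  \<open>A (B Y) = D Y\<close> is the orthogonal projector onto the range of \<open>A\<close>, and \<open>B Y\<close> inverts \<open>A\<close> on that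
  range; what remains is that the range of \<open>B Y\<close> lies in that of \<open>A\<close>
  (\<open>core_inverse_of_factor\<close>).
\<close>

section \<open>The involutive algebra of square tensors\<close>

lemma finite_multi_indices: "finite (multi_indices N)"
proof (rule finite_subset)
  show "multi_indices N \<subseteq> {i. set i \<subseteq> {..sum_list N} \<and> length i = length N}"
    by (auto simp: multi_indices_def in_set_conv_nth) (metis elem_le_sum_list le_trans)
  show "finite {i. set i \<subseteq> {..sum_list N} \<and> length i = length N}"
    by (rule finite_lists_length_eq) simp
qed

lemma sq_tensor_eqI:
  assumes "A \<in> sq_tensors N" "B \<in> sq_tensors N"
    and "\<And>i j. i \<in> multi_indices N \<Longrightarrow> j \<in> multi_indices N \<Longrightarrow> A (i, j) = B (i, j)"
  shows "A = B"
  using assms unfolding sq_tensors_def by (intro PiE_ext) auto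

lemma einstein_prod_in: "A \<star>\<^bsub>N\<^esub> B \<in> sq_tensors N"
  by (auto simp: einstein_prod_def sq_tensors_def)

lemma unit_tensor_in: "unit_tensor N \<in> sq_tensors N"
  by (auto simp: unit_tensor_def sq_tensors_def)

lemma conj_transpose_in: "conj_transpose N A \<in> sq_tensors N"
  by (auto simp: conj_transpose_def sq_tensors_def)

lemma tensor_pow_in: "tensor_pow N A k \<in> sq_tensors N"
  by (cases k) (simp_all add: unit_tensor_in einstein_prod_in)

lemma einstein_prod_entry:
  "i \<in> multi_indices N \<Longrightarrow> j \<in> multi_indices N \<Longrightarrow>
   (A \<star>\<^bsub>N\<^esub> B) (i, j) = (\<Sum>k\<in>multi_indices N. A (i, k) * B (k, j))"
  by (simp add: einstein_prod_def)

lemma einstein_prod_assoc: "(A \<star>\<^bsub>N\<^esub> B) \<star>\<^bsub>N\<^esub> C = A \<star>\<^bsub>N\<^esub> (B \<star>\<^bsub>N\<^esub> C)"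
proof (rule sq_tensor_eqI[OF einstein_prod_in einstein_prod_in])
  fix i j assume ij: "i \<in> multi_indices N" "j \<in> multi_indices N"
  let ?I = "multi_indices N"
  have "((A \<star>\<^bsub>N\<^esub> B) \<star>\<^bsub>N\<^esub> C) (i, j) = (\<Sum>k\<in>?I. \<Sum>l\<in>?I. A (i, l) * B (l, k) * C (k, j))"
    using ij by (simp add: einstein_prod_entry sum_distrib_right)
  also have "\<dots> = (\<Sum>l\<in>?I. \<Sum>k\<in>?I. A (i, l) * B (l, k) * C (k, j))"
    by (rule sum.swap)
  also have "\<dots> = (A \<star>\<^bsub>N\<^esub> (B \<star>\<^bsub>N\<^esub> C)) (i, j)"
    using ij by (simp add: einstein_prod_entry sum_distrib_left mult.assoc)
  finally show "((A \<star>\<^bsub>N\<^esub> B) \<star>\<^bsub>N\<^esub> C) (i, j) = (A \<star>\<^bsub>N\<^esub> (B \<star>\<^bsub>N\<^esub> C)) (i, j)" .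
qed

lemma unit_tensor_left: "A \<in> sq_tensors N \<Longrightarrow> unit_tensor N \<star>\<^bsub>N\<^esub> A = A"
  by (rule sq_tensor_eqI[OF einstein_prod_in])
    (simp_all add: einstein_prod_entry unit_tensor_def if_distrib[of "\<lambda>x. x * _"]
      finite_multi_indices cong: if_cong)

lemma unit_tensor_right: "A \<in> sq_tensors N \<Longrightarrow> A \<star>\<^bsub>N\<^esub> unit_tensor N = A"
  by (rule sq_tensor_eqI[OF einstein_prod_in])
    (simp_all add: einstein_prod_entry unit_tensor_def if_distrib[of "\<lambda>x. _ * x"]
      finite_multi_indices cong: if_cong)

lemma conj_transpose_prod:
  "conj_transpose N (A \<star>\<^bsub>N\<^esub> B) = conj_transpose N B \<star>\<^bsub>N\<^esub> conj_transpose N A"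
  by (rule sq_tensor_eqI[OF conj_transpose_in einstein_prod_in])
    (simp add: einstein_prod_entry conj_transpose_def mult.commute)

lemma conj_transpose_twice:
  "A \<in> sq_tensors N \<Longrightarrow> conj_transpose N (conj_transpose N A) = A"
  by (rule sq_tensor_eqI[OF conj_transpose_in]) (simp_all add: conj_transpose_def)

text \<open>
  The involution is proper: the \<open>(j, j)\<close> entry of \<open>D\<^sup>* D\<close>, with \<open>D = A (X - Y)\<close>, is the squared
  norm of column \<open>j\<close> of \<open>D\<close>.
\<close>

lemma conj_transpose_cancel:
  assumes "conj_transpose N A \<star>\<^bsub>N\<^esub> (A \<star>\<^bsub>N\<^esub> X) = conj_transpose N A \<star>\<^bsub>N\<^esub> (A \<star>\<^bsub>N\<^esub> Y)"
  shows "A \<star>\<^bsub>N\<^esub> X = A \<star>\<^bsub>N\<^esub> Y"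
proof (rule sq_tensor_eqI[OF einstein_prod_in einstein_prod_in])
  fix i j assume ij: "i \<in> multi_indices N" "j \<in> multi_indices N"
  let ?I = "multi_indices N" and ?d = "\<lambda>k. (A \<star>\<^bsub>N\<^esub> X) (k, j) - (A \<star>\<^bsub>N\<^esub> Y) (k, j)"
  let ?z = "\<lambda>l. X (l, j) - Y (l, j)"
  have orth: "(\<Sum>k\<in>?I. cnj (A (k, l)) * ?d k) = 0" if l: "l \<in> ?I" for l
  proof -
    have "(\<Sum>k\<in>?I. conj_transpose N A (l, k) * (A \<star>\<^bsub>N\<^esub> X) (k, j)) =
          (\<Sum>k\<in>?I. conj_transpose N A (l, k) * (A \<star>\<^bsub>N\<^esub> Y) (k, j))"
      using arg_cong[OF assms, of "\<lambda>T. T (l, j)"] l ij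
      by (simp only: einstein_prod_entry[of l N j "conj_transpose N A"])
    then show ?thesis
      using l by (simp add: conj_transpose_def right_diff_distrib sum_subtractf)
  qed
  have d: "?d k = (\<Sum>l\<in>?I. A (k, l) * ?z l)" if "k \<in> ?I" for k
    using that ij by (simp add: einstein_prod_entry right_diff_distrib sum_subtractf)
  have "(\<Sum>k\<in>?I. cnj (?d k) * ?d k) = (\<Sum>k\<in>?I. \<Sum>l\<in>?I. cnj (?z l) * (cnj (A (k, l)) * ?d k))"
  proof (rule sum.cong[OF refl])
    fix k assume k: "k \<in> ?I"
    have "cnj (?d k) = (\<Sum>l\<in>?I. cnj (A (k, l)) * cnj (?z l))"
      unfolding d[OF k] by simp
    then show "cnj (?d k) * ?d k = (\<Sum>l\<in>?I. cnj (?z l) * (cnj (A (k, l)) * ?d k))"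
      by (simp only: sum_distrib_right) (intro sum.cong refl; simp only: mult_ac)
  qed
  also have "\<dots> = (\<Sum>l\<in>?I. cnj (?z l) * (\<Sum>k\<in>?I. cnj (A (k, l)) * ?d k))"
    by (subst sum.swap) (simp only: sum_distrib_left)
  also have "\<dots> = 0"
    by (rule sum.neutral, rule ballI, simp only: orth mult_zero_right)
  finally have "(\<Sum>k\<in>?I. complex_of_real ((cmod (?d k))\<^sup>2)) = 0"
    by (simp only: complex_norm_square mult.commute)
  then have "(\<Sum>k\<in>?I. (cmod (?d k))\<^sup>2) = 0"
    by (simp only: of_real_sum[symmetric] of_real_eq_0_iff)
  then show "(A \<star>\<^bsub>N\<^esub> X) (i, j) = (A \<star>\<^bsub>N\<^esub> Y) (i, j)"
    using ij by (subst (asm) sum_nonneg_eq_0_iff) (auto simp: finite_multi_indices)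
qed

lemma tensor_pow_add: "tensor_pow N A (m + k) = tensor_pow N A m \<star>\<^bsub>N\<^esub> tensor_pow N A k"
  by (induction k) (simp_all add: unit_tensor_right tensor_pow_in einstein_prod_assoc)

lemma tensor_pow_2: "A \<in> sq_tensors N \<Longrightarrow> tensor_pow N A 2 = A \<star>\<^bsub>N\<^esub> A"
  by (simp add: numeral_2_eq_2 unit_tensor_left)

lemma tensor_pow_Suc_left:
  "A \<in> sq_tensors N \<Longrightarrow> tensor_pow N A (Suc k) = A \<star>\<^bsub>N\<^esub> tensor_pow N A k"
  using tensor_pow_add[of N A "Suc 0" k] by (simp add: unit_tensor_left)

section \<open>Inclusion of ranges as left divisibility\<close>

lemma einstein_apply_prod: "(A \<star>\<^bsub>N\<^esub> B) \<star>v\<^bsub>N\<^esub> X = A \<star>v\<^bsub>N\<^esub> (B \<star>v\<^bsub>N\<^esub> X)"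
proof
  fix i
  let ?I = "multi_indices N"
  show "((A \<star>\<^bsub>N\<^esub> B) \<star>v\<^bsub>N\<^esub> X) i = (A \<star>v\<^bsub>N\<^esub> (B \<star>v\<^bsub>N\<^esub> X)) i"
  proof (cases "i \<in> ?I")
    case True
    then have "((A \<star>\<^bsub>N\<^esub> B) \<star>v\<^bsub>N\<^esub> X) i = (\<Sum>k\<in>?I. \<Sum>l\<in>?I. A (i, l) * B (l, k) * X k)"
      by (simp add: einstein_apply_def einstein_prod_entry sum_distrib_right)
    also have "\<dots> = (\<Sum>l\<in>?I. \<Sum>k\<in>?I. A (i, l) * B (l, k) * X k)"
      by (rule sum.swap)
    finally show ?thesis
      using True by (simp add: einstein_apply_def sum_distrib_left mult.assoc)
  qed (simp add: einstein_apply_def)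
qed

text \<open>Column \<open>j\<close> of \<open>W\<close> is a preimage under \<open>M\<close> of column \<open>j\<close> of \<open>A\<close>.\<close>

lemma tensor_range_subset_iff:
  assumes A: "A \<in> sq_tensors N"
  shows "tensor_range N A \<subseteq> tensor_range N M \<longleftrightarrow> (\<exists>W. A = M \<star>\<^bsub>N\<^esub> W)"
proof
  let ?I = "multi_indices N"
  assume sub: "tensor_range N A \<subseteq> tensor_range N M"
  have "\<exists>x. \<forall>i\<in>?I. A (i, j) = (\<Sum>k\<in>?I. M (i, k) * x k)" if j: "j \<in> ?I" for j
  proof -
    let ?e = "\<lambda>k\<in>?I. if k = j then 1 else 0 :: complex"
    have "A \<star>v\<^bsub>N\<^esub> ?e \<in> tensor_range N A"
      by (auto simp: tensor_range_def vec_tensors_def)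
    with sub obtain x where x: "A \<star>v\<^bsub>N\<^esub> ?e = M \<star>v\<^bsub>N\<^esub> x"
      by (auto simp: tensor_range_def)
    have "A (i, j) = (\<Sum>k\<in>?I. M (i, k) * x k)" if "i \<in> ?I" for i
      using arg_cong[OF x, of "\<lambda>v. v i"] that j
      by (simp add: einstein_apply_def if_distrib[of "\<lambda>x. _ * x"] finite_multi_indices
          cong: if_cong)
    then show ?thesis by blast
  qed
  then obtain x where x: "\<And>j i. j \<in> ?I \<Longrightarrow> i \<in> ?I \<Longrightarrow> A (i, j) = (\<Sum>k\<in>?I. M (i, k) * x j k)"
    by metis
  have "A = M \<star>\<^bsub>N\<^esub> (\<lambda>(k, j). x j k)"
    by (rule sq_tensor_eqI[OF A einstein_prod_in]) (simp add: einstein_prod_entry x)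
  then show "\<exists>W. A = M \<star>\<^bsub>N\<^esub> W" by blast
next
  have "W \<star>v\<^bsub>N\<^esub> X \<in> vec_tensors N" for W X
    by (simp add: einstein_apply_def vec_tensors_def)
  moreover assume "\<exists>W. A = M \<star>\<^bsub>N\<^esub> W"
  ultimately show "tensor_range N A \<subseteq> tensor_range N M"
    by (auto simp: tensor_range_def einstein_apply_prod)
qed

section \<open>Strong pi-regularity\<close>

text \<open>A homogeneous linear system with more unknowns than equations has a nontrivial solution.\<close>

lemma exists_nontrivial_solution:
  fixes f :: "'t \<Rightarrow> 's \<Rightarrow> 'a :: field"
  assumes "finite S" "finite T" "card S < card T"
  shows "\<exists>c. (\<exists>t\<in>T. c t \<noteq> 0) \<and> (\<forall>s\<in>S. (\<Sum>t\<in>T. c t * f t s) = 0)"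
  using assms
proof (induction S arbitrary: T f rule: finite_induct)
  case empty
  then obtain t where "t \<in> T" by fastforce
  then show ?case by (intro exI[of _ "\<lambda>_. 1"]) auto
next
  case (insert s S)
  show ?case
  proof (cases "\<forall>t\<in>T. f t s = 0")
    case True
    obtain c where "\<exists>t\<in>T. c t \<noteq> 0" "\<forall>r\<in>S. (\<Sum>t\<in>T. c t * f t r) = 0"
      using insert.IH[of T f] insert.prems insert.hyps by auto
    then show ?thesis using True by (intro exI[of _ c]) auto
  next
    case False
    then obtain u where u: "u \<in> T" "f u s \<noteq> 0" by blast
    let ?T = "T - {u}"
    \<comment> \<open>Gaussian elimination of the unknown \<open>c u\<close> by means of the equation \<open>s\<close>.\<close>
    let ?g = "\<lambda>t r. f t r - f t s / f u s * f u r"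
    have "card S < card ?T"
      using insert.prems insert.hyps u by simp
    then obtain c where c: "\<exists>t\<in>?T. c t \<noteq> 0" "\<forall>r\<in>S. (\<Sum>t\<in>?T. c t * ?g t r) = 0"
      using insert.IH[of ?T ?g] insert.prems by auto
    define b where "b = - (\<Sum>t\<in>?T. c t * f t s) / f u s"
    define c' where "c' = c(u := b)"
    have split: "(\<Sum>t\<in>T. c' t * f t r) = b * f u r + (\<Sum>t\<in>?T. c t * f t r)" for r
      using insert.prems(1) u(1) by (simp add: sum.remove c'_def)
    have "(\<Sum>t\<in>?T. c t * ?g t r) = (\<Sum>t\<in>?T. c t * f t r) + b * f u r" for r
      by (simp add: b_def right_diff_distrib sum_subtractf sum_distrib_right sum_divide_distrib
          mult.assoc)
    then have "\<forall>r\<in>S. (\<Sum>t\<in>T. c' t * f t r) = 0"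
      using c(2) split by (simp add: add.commute)
    moreover have "(\<Sum>t\<in>T. c' t * f t s) = 0"
      using u split by (simp add: b_def)
    moreover have "\<exists>t\<in>T. c' t \<noteq> 0"
      using c(1) by (auto simp: c'_def)
    ultimately show ?thesis by blast
  qed
qed

text \<open>
  The powers of \<open>M\<close> are linearly dependent.  Solving a dependence for its lowest power expresses
  \<open>M\<^sup>k\<close> as \<open>M\<^sup>k\<^sup>+\<^sup>1 C\<close> with \<open>C\<close> a polynomial in \<open>M\<close>.
\<close>

lemma strongly_pi_regular:
  assumes M: "M \<in> sq_tensors N"
  obtains k C where "C \<in> sq_tensors N" "M \<star>\<^bsub>N\<^esub> C = C \<star>\<^bsub>N\<^esub> M"
    "tensor_pow N M k = tensor_pow N M (Suc k) \<star>\<^bsub>N\<^esub> C"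
proof -
  let ?I = "multi_indices N"
  let ?P = "tensor_pow N M"
  define d where "d = card (?I \<times> ?I)"
  have "\<exists>c. (\<exists>t\<in>{..d}. c t \<noteq> 0) \<and> (\<forall>s\<in>?I \<times> ?I. (\<Sum>t\<in>{..d}. c t * ?P t s) = 0)"
    by (rule exists_nontrivial_solution) (simp_all add: finite_multi_indices d_def)
  then obtain c t where ct: "t \<le> d" "c t \<noteq> 0"
    and dep: "\<And>s. s \<in> ?I \<times> ?I \<Longrightarrow> (\<Sum>t\<le>d. c t * ?P t s) = 0"
    by auto
  define k where "k = (LEAST t. c t \<noteq> 0)"
  have k: "c k \<noteq> 0" "k \<le> d"
    using LeastI[of "\<lambda>t. c t \<noteq> 0" t] Least_le[of "\<lambda>t. c t \<noteq> 0" t] ct by (auto simp: k_def)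
  have below: "c t = 0" if "t < k" for t
    using that not_less_Least k_def by blast
  let ?J = "{Suc k..d}"
  let ?e = "\<lambda>t. - c t / c k"
  define C where "C = (\<lambda>p\<in>?I \<times> ?I. \<Sum>t\<in>?J. ?e t * ?P (t - Suc k) p)"
  have "C \<in> sq_tensors N"
    by (auto simp: C_def sq_tensors_def)
  have left: "(A \<star>\<^bsub>N\<^esub> C) (i, j) = (\<Sum>t\<in>?J. ?e t * (A \<star>\<^bsub>N\<^esub> ?P (t - Suc k)) (i, j))"
    if "i \<in> ?I" "j \<in> ?I" for A i j
  proof -
    have "(A \<star>\<^bsub>N\<^esub> C) (i, j) = (\<Sum>l\<in>?I. \<Sum>t\<in>?J. ?e t * (A (i, l) * ?P (t - Suc k) (l, j)))"
      using that by (simp add: einstein_prod_entry C_def sum_distrib_left mult.left_commute)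
    also have "\<dots> = (\<Sum>t\<in>?J. \<Sum>l\<in>?I. ?e t * (A (i, l) * ?P (t - Suc k) (l, j)))"
      by (rule sum.swap)
    finally show ?thesis
      using that by (simp only: einstein_prod_entry sum_distrib_left)
  qed
  have right: "(C \<star>\<^bsub>N\<^esub> A) (i, j) = (\<Sum>t\<in>?J. ?e t * (?P (t - Suc k) \<star>\<^bsub>N\<^esub> A) (i, j))"
    if "i \<in> ?I" "j \<in> ?I" for A i j
  proof -
    have "(C \<star>\<^bsub>N\<^esub> A) (i, j) = (\<Sum>l\<in>?I. \<Sum>t\<in>?J. ?e t * (?P (t - Suc k) (i, l) * A (l, j)))"
      using that by (simp add: einstein_prod_entry C_def sum_distrib_right mult.assoc)
    also have "\<dots> = (\<Sum>t\<in>?J. \<Sum>l\<in>?I. ?e t * (?P (t - Suc k) (i, l) * A (l, j)))"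
      by (rule sum.swap)
    finally show ?thesis
      using that by (simp only: einstein_prod_entry sum_distrib_left)
  qed
  have "M \<star>\<^bsub>N\<^esub> C = C \<star>\<^bsub>N\<^esub> M"
  proof (rule sq_tensor_eqI[OF einstein_prod_in einstein_prod_in])
    have "M \<star>\<^bsub>N\<^esub> ?P m = ?P m \<star>\<^bsub>N\<^esub> M" for m
      using tensor_pow_Suc_left[OF M, of m] by simp
    then show "(M \<star>\<^bsub>N\<^esub> C) (i, j) = (C \<star>\<^bsub>N\<^esub> M) (i, j)" if "i \<in> ?I" "j \<in> ?I" for i j
      using that by (simp only: left right)
  qed
  moreover have "?P k = ?P (Suc k) \<star>\<^bsub>N\<^esub> C"
  proof (rule sq_tensor_eqI[OF tensor_pow_in einstein_prod_in])
    fix i j assume ij: "i \<in> ?I" "j \<in> ?I"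
    have "0 = (\<Sum>t\<le>d. c t * ?P t (i, j))"
      using dep ij by simp
    also have "\<dots> = (\<Sum>t\<in>insert k ?J. c t * ?P t (i, j))"
      using k below by (intro sum.mono_neutral_right) (auto simp: not_less_eq_eq)
    also have "\<dots> = c k * ?P k (i, j) + (\<Sum>t\<in>?J. c t * ?P t (i, j))"
      by simp
    finally have "?P k (i, j) = - (\<Sum>t\<in>?J. c t * ?P t (i, j)) / c k"
      using k by (simp add: field_simps eq_neg_iff_add_eq_0)
    also have "\<dots> = (\<Sum>t\<in>?J. ?e t * ?P t (i, j))"
      by (simp add: sum_divide_distrib sum_negf)
    also have "\<dots> = (\<Sum>t\<in>?J. ?e t * (?P (Suc k) \<star>\<^bsub>N\<^esub> ?P (t - Suc k)) (i, j))"
      by (intro sum.cong refl) (simp only: tensor_pow_add[symmetric] atLeastAtMost_iff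
          le_add_diff_inverse)
    finally show "?P k (i, j) = (?P (Suc k) \<star>\<^bsub>N\<^esub> C) (i, j)"
      using ij by (simp only: left)
  qed
  ultimately show thesis
    using that \<open>C \<in> sq_tensors N\<close> by blast
qed

text \<open>
  Strong pi-regularity makes the set of exponents in the definition of the index nonempty, so the
  index does have the property that defines it.
\<close>

lemma index_1_factor:
  assumes A: "A \<in> sq_tensors N" and ind: "tensor_index N A = 1"
  obtains W where "A = A \<star>\<^bsub>N\<^esub> (A \<star>\<^bsub>N\<^esub> W)"
proof -
  let ?P = "tensor_pow N A"
  let ?Q = "\<lambda>k. 0 < k \<and> tensor_range N (?P k) = tensor_range N (?P (k + 1))"
  obtain k C where "?P k = ?P (Suc k) \<star>\<^bsub>N\<^esub> C"
    using strongly_pi_regular[OF A] by metis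
  then have "?P (Suc k) = ?P (Suc k + 1) \<star>\<^bsub>N\<^esub> C"
    by (metis Suc_eq_plus1 tensor_pow_Suc_left[OF A] einstein_prod_assoc)
  moreover have "?P (Suc k + 1) = ?P (Suc k) \<star>\<^bsub>N\<^esub> A"
    by simp
  ultimately have "?Q (Suc k)"
    using tensor_range_subset_iff[OF tensor_pow_in] by (metis subset_antisym zero_less_Suc)
  then have "?Q (tensor_index N A)"
    unfolding tensor_index_def by (rule LeastI)
  then have "tensor_range N A \<subseteq> tensor_range N (A \<star>\<^bsub>N\<^esub> A)"
    using A by (simp add: ind unit_tensor_left)
  then show thesis
    using that tensor_range_subset_iff[OF A] einstein_prod_assoc by metis
qed

section \<open>Existence and uniqueness of the core inverse\<close>

lemma square_divides_imp_commuting_inverse: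
  assumes A: "A \<in> sq_tensors N" and W: "A = A \<star>\<^bsub>N\<^esub> (A \<star>\<^bsub>N\<^esub> W)"
  obtains C where "A \<star>\<^bsub>N\<^esub> C = C \<star>\<^bsub>N\<^esub> A" "A = C \<star>\<^bsub>N\<^esub> (A \<star>\<^bsub>N\<^esub> A)"
proof -
  let ?P = "tensor_pow N A"
  obtain k C where C: "A \<star>\<^bsub>N\<^esub> C = C \<star>\<^bsub>N\<^esub> A" "?P k = ?P (Suc k) \<star>\<^bsub>N\<^esub> C"
    using strongly_pi_regular[OF A] by metis
  have comm: "?P m \<star>\<^bsub>N\<^esub> C = C \<star>\<^bsub>N\<^esub> ?P m" if "m > 0" for m
    using that
  proof (induction m rule: nat_induct_non_zero)
    case 1
    show ?case using C(1) A by (simp add: unit_tensor_left)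
  next
    case (Suc m)
    then show ?case using C(1) by (simp add: einstein_prod_assoc) (metis einstein_prod_assoc)
  qed
  have "\<exists>V. A = ?P m \<star>\<^bsub>N\<^esub> V" for m
  proof (induction m)
    case 0
    then show ?case using A by (metis tensor_pow.simps(1) unit_tensor_left)
  next
    case (Suc m)
    then obtain V where V: "A = ?P m \<star>\<^bsub>N\<^esub> V" by blast
    have "A = A \<star>\<^bsub>N\<^esub> (?P m \<star>\<^bsub>N\<^esub> (V \<star>\<^bsub>N\<^esub> W))"
      using V W by (metis einstein_prod_assoc)
    then show ?case using tensor_pow_Suc_left[OF A] by (metis einstein_prod_assoc)
  qed
  then obtain V where V: "A = ?P k \<star>\<^bsub>N\<^esub> V" by blast
  have "A = (C \<star>\<^bsub>N\<^esub> ?P (Suc k)) \<star>\<^bsub>N\<^esub> V"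
    using V C(2) comm[of "Suc k"] by (metis zero_less_Suc)
  also have "\<dots> = C \<star>\<^bsub>N\<^esub> (A \<star>\<^bsub>N\<^esub> A)"
    using V tensor_pow_Suc_left[OF A] by (metis einstein_prod_assoc)
  finally show thesis using that C(1) by blast
qed

text \<open>
  The witness \<open>Y = C A\<^sup>*\<close> comes from strong pi-regularity of \<open>H = A\<^sup>* A\<close>: properness of the
  involution cancels \<open>H\<^sup>k = H\<^sup>k\<^sup>+\<^sup>1 C\<close> down to \<open>A = A H C\<close>.
\<close>

lemma exists_inverse_13:
  assumes A: "A \<in> sq_tensors N"
  obtains Y where "A \<star>\<^bsub>N\<^esub> (Y \<star>\<^bsub>N\<^esub> A) = A" "conj_transpose N (A \<star>\<^bsub>N\<^esub> Y) = A \<star>\<^bsub>N\<^esub> Y"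
proof -
  let ?s = "conj_transpose N"
  define H where "H = ?s A \<star>\<^bsub>N\<^esub> A"
  have H: "H \<in> sq_tensors N" "?s H = H"
    using A by (simp_all add: H_def einstein_prod_in conj_transpose_prod conj_transpose_twice)
  obtain k C where C: "H \<star>\<^bsub>N\<^esub> C = C \<star>\<^bsub>N\<^esub> H"
    "tensor_pow N H k = tensor_pow N H (Suc k) \<star>\<^bsub>N\<^esub> C"
    using strongly_pi_regular[OF H(1)] by metis
  have cancelH: "H \<star>\<^bsub>N\<^esub> X = H \<star>\<^bsub>N\<^esub> Z" if "H \<star>\<^bsub>N\<^esub> (H \<star>\<^bsub>N\<^esub> X) = H \<star>\<^bsub>N\<^esub> (H \<star>\<^bsub>N\<^esub> Z)" for X Z
    using conj_transpose_cancel[of N H X Z] that H(2) by simp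
  have cancel: "H \<star>\<^bsub>N\<^esub> X = H \<star>\<^bsub>N\<^esub> Z"
    if "tensor_pow N H (Suc m) \<star>\<^bsub>N\<^esub> X = tensor_pow N H (Suc m) \<star>\<^bsub>N\<^esub> Z" for m X Z
    using that
  proof (induction m)
    case 0
    then show ?case using H(1) by (simp add: unit_tensor_left)
  next
    case (Suc m)
    have "H \<star>\<^bsub>N\<^esub> (H \<star>\<^bsub>N\<^esub> (tensor_pow N H m \<star>\<^bsub>N\<^esub> X)) = H \<star>\<^bsub>N\<^esub> (H \<star>\<^bsub>N\<^esub> (tensor_pow N H m \<star>\<^bsub>N\<^esub> Z))"
      using Suc.prems by (metis tensor_pow_Suc_left[OF H(1)] einstein_prod_assoc)
    then have "tensor_pow N H (Suc m) \<star>\<^bsub>N\<^esub> X = tensor_pow N H (Suc m) \<star>\<^bsub>N\<^esub> Z"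
      using cancelH by (metis tensor_pow_Suc_left[OF H(1)] einstein_prod_assoc)
    then show ?case by (rule Suc.IH)
  qed
  have "tensor_pow N H (Suc k) \<star>\<^bsub>N\<^esub> (H \<star>\<^bsub>N\<^esub> C) = tensor_pow N H (Suc k) \<star>\<^bsub>N\<^esub> unit_tensor N"
    by (metis C(2) tensor_pow_Suc_left[OF H(1)] einstein_prod_assoc tensor_pow.simps(2)
        tensor_pow_in unit_tensor_right)
  then have "H \<star>\<^bsub>N\<^esub> (H \<star>\<^bsub>N\<^esub> C) = H \<star>\<^bsub>N\<^esub> unit_tensor N"
    by (rule cancel)
  then have "?s A \<star>\<^bsub>N\<^esub> (A \<star>\<^bsub>N\<^esub> (H \<star>\<^bsub>N\<^esub> C)) = ?s A \<star>\<^bsub>N\<^esub> (A \<star>\<^bsub>N\<^esub> unit_tensor N)"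
    by (simp add: H_def einstein_prod_assoc)
  then have AHC: "A \<star>\<^bsub>N\<^esub> (H \<star>\<^bsub>N\<^esub> C) = A"
    using conj_transpose_cancel A by (metis unit_tensor_right)
  define E where "E = A \<star>\<^bsub>N\<^esub> (C \<star>\<^bsub>N\<^esub> ?s A)"
  have EA: "E \<star>\<^bsub>N\<^esub> A = A"
    using AHC C(1) by (simp add: E_def H_def einstein_prod_assoc)
  \<comment> \<open>\<open>E A = A\<close> gives \<open>A\<^sup>* = A\<^sup>* E\<^sup>*\<close>, hence \<open>E = E E\<^sup>*\<close>.\<close>
  then have "?s A \<star>\<^bsub>N\<^esub> ?s E = ?s A"
    by (simp flip: conj_transpose_prod)
  then have "E \<star>\<^bsub>N\<^esub> ?s E = E"
    by (simp add: E_def einstein_prod_assoc)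
  then have "?s E = E"
    by (metis conj_transpose_prod conj_transpose_twice einstein_prod_in E_def)
  then show thesis
    using that[of "C \<star>\<^bsub>N\<^esub> ?s A"] EA by (simp add: E_def einstein_prod_assoc)
qed

lemma is_core_inverse_iff:
  assumes "A \<in> sq_tensors N"
  shows "is_core_inverse N A X \<longleftrightarrow> X \<in> sq_tensors N \<and>
     conj_transpose N (A \<star>\<^bsub>N\<^esub> X) = A \<star>\<^bsub>N\<^esub> X \<and>
     X \<star>\<^bsub>N\<^esub> (A \<star>\<^bsub>N\<^esub> A) = A \<and> A \<star>\<^bsub>N\<^esub> (X \<star>\<^bsub>N\<^esub> X) = X"
  using assms by (auto simp: is_core_inverse_def tensor_pow_2)

lemma square_divides_imp_core_inverse:
  assumes A: "A \<in> sq_tensors N" and W: "A = A \<star>\<^bsub>N\<^esub> (A \<star>\<^bsub>N\<^esub> W)"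
  shows "has_core_inverse N A"
proof -
  obtain C where C: "A \<star>\<^bsub>N\<^esub> C = C \<star>\<^bsub>N\<^esub> A" "A = C \<star>\<^bsub>N\<^esub> (A \<star>\<^bsub>N\<^esub> A)"
    using square_divides_imp_commuting_inverse[OF A W] by metis
  obtain Y where Y: "A \<star>\<^bsub>N\<^esub> (Y \<star>\<^bsub>N\<^esub> A) = A" "conj_transpose N (A \<star>\<^bsub>N\<^esub> Y) = A \<star>\<^bsub>N\<^esub> Y"
    using exists_inverse_13[OF A] by metis
  define X where "X = C \<star>\<^bsub>N\<^esub> (A \<star>\<^bsub>N\<^esub> Y)"
  have AX: "A \<star>\<^bsub>N\<^esub> X = A \<star>\<^bsub>N\<^esub> Y"
    unfolding X_def using C by (metis einstein_prod_assoc)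
  have "X \<star>\<^bsub>N\<^esub> (A \<star>\<^bsub>N\<^esub> A) = A"
    unfolding X_def using C Y(1) by (metis einstein_prod_assoc)
  moreover have "A \<star>\<^bsub>N\<^esub> (X \<star>\<^bsub>N\<^esub> X) = X"
  proof -
    have "A \<star>\<^bsub>N\<^esub> (X \<star>\<^bsub>N\<^esub> X) = (A \<star>\<^bsub>N\<^esub> Y) \<star>\<^bsub>N\<^esub> ((A \<star>\<^bsub>N\<^esub> C) \<star>\<^bsub>N\<^esub> Y)"
      using AX C(1) by (metis einstein_prod_assoc X_def)
    also have "\<dots> = (A \<star>\<^bsub>N\<^esub> (Y \<star>\<^bsub>N\<^esub> A)) \<star>\<^bsub>N\<^esub> (C \<star>\<^bsub>N\<^esub> Y)"
      by (simp only: einstein_prod_assoc)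
    also have "\<dots> = X"
      using Y(1) C(1) by (metis einstein_prod_assoc X_def)
    finally show ?thesis .
  qed
  ultimately have "is_core_inverse N A X"
    using A AX Y(2) by (simp add: is_core_inverse_iff) (simp add: X_def einstein_prod_in)
  then show ?thesis by (auto simp: has_core_inverse_def)
qed

lemma core_inverse_inner:
  assumes "A \<in> sq_tensors N" "is_core_inverse N A X"
  shows "A \<star>\<^bsub>N\<^esub> (X \<star>\<^bsub>N\<^esub> A) = A"
  using assms by (simp add: is_core_inverse_iff) (metis einstein_prod_assoc)

lemma is_core_inverse_unique:
  assumes A: "A \<in> sq_tensors N" and X: "is_core_inverse N A X" and Y: "is_core_inverse N A Y"
  shows "X = Y"
proof -
  note inner = core_inverse_inner[OF A X] core_inverse_inner[OF A Y]
  note X' = X[unfolded is_core_inverse_iff[OF A]] and Y' = Y[unfolded is_core_inverse_iff[OF A]]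
  \<comment> \<open>\<open>A X\<close> and \<open>A Y\<close> are self-adjoint idempotents that absorb each other from the left.\<close>
  have "(A \<star>\<^bsub>N\<^esub> X) \<star>\<^bsub>N\<^esub> (A \<star>\<^bsub>N\<^esub> Y) = A \<star>\<^bsub>N\<^esub> Y" "(A \<star>\<^bsub>N\<^esub> Y) \<star>\<^bsub>N\<^esub> (A \<star>\<^bsub>N\<^esub> X) = A \<star>\<^bsub>N\<^esub> X"
    using inner by (metis einstein_prod_assoc)+
  then have eq: "A \<star>\<^bsub>N\<^esub> X = A \<star>\<^bsub>N\<^esub> Y"
    using X' Y' by (metis conj_transpose_prod)
  \<comment> \<open>\<open>Z = A Z\<^sup>2\<close> lies in the range of \<open>A\<close>, where \<open>X\<close> inverts \<open>A\<close>.\<close>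
  have absorb: "X \<star>\<^bsub>N\<^esub> (A \<star>\<^bsub>N\<^esub> Z) = Z" if "A \<star>\<^bsub>N\<^esub> (Z \<star>\<^bsub>N\<^esub> Z) = Z" for Z
    using that X' by (metis einstein_prod_assoc)
  show ?thesis
    using absorb[of X] absorb[of Y] eq X' Y' by metis
qed

lemma core_inverse_eqI:
  assumes "A \<in> sq_tensors N" "is_core_inverse N A X"
  shows "core_inverse N A = X"
  unfolding core_inverse_def using assms is_core_inverse_unique by (blast intro: the_equality)

section \<open>The reverse order identity\<close>

text \<open>
  The factorization \<open>A = B A B W\<close> says that \<open>B\<close> maps the range of \<open>A B\<close> onto at least the range of \<open>A\<close>.
  The core inverse \<open>B Y\<close> needs the opposite inclusion: \<open>B A = A Q\<close> for some \<open>Q\<close>.  It holds because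
  \<open>A B\<close> is injective on the range of \<open>A\<close>.
\<close>

lemma core_inverse_of_factor:
  assumes A: "A \<in> sq_tensors N" and ind: "A = A \<star>\<^bsub>N\<^esub> (A \<star>\<^bsub>N\<^esub> V)"
    and W: "A = B \<star>\<^bsub>N\<^esub> (A \<star>\<^bsub>N\<^esub> (B \<star>\<^bsub>N\<^esub> W))"
  obtains Y where "is_core_inverse N (A \<star>\<^bsub>N\<^esub> B) Y" "is_core_inverse N A (B \<star>\<^bsub>N\<^esub> Y)"
proof -
  define D where "D = A \<star>\<^bsub>N\<^esub> B"
  have D: "D \<in> sq_tensors N" by (simp add: D_def einstein_prod_in)
  have BDW: "A = B \<star>\<^bsub>N\<^esub> (D \<star>\<^bsub>N\<^esub> W)"
    using W by (simp add: D_def einstein_prod_assoc)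
  have DDW: "A \<star>\<^bsub>N\<^esub> A = D \<star>\<^bsub>N\<^esub> (D \<star>\<^bsub>N\<^esub> W)"
    using BDW by (metis D_def einstein_prod_assoc)
  then have ADD: "A = D \<star>\<^bsub>N\<^esub> (D \<star>\<^bsub>N\<^esub> (W \<star>\<^bsub>N\<^esub> V))"
    using ind by (metis einstein_prod_assoc)
  then have "D = D \<star>\<^bsub>N\<^esub> (D \<star>\<^bsub>N\<^esub> (W \<star>\<^bsub>N\<^esub> (V \<star>\<^bsub>N\<^esub> B)))"
    by (metis D_def einstein_prod_assoc)
  then obtain Y where Ycore: "is_core_inverse N D Y"
    using square_divides_imp_core_inverse[OF D] has_core_inverse_def by blast
  note Y = Ycore[unfolded is_core_inverse_iff[OF D]]
  have YD: "Y \<star>\<^bsub>N\<^esub> (D \<star>\<^bsub>N\<^esub> (D \<star>\<^bsub>N\<^esub> Q)) = D \<star>\<^bsub>N\<^esub> Q" for Q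
    using Y by (metis einstein_prod_assoc)
  have AZ: "A \<star>\<^bsub>N\<^esub> (B \<star>\<^bsub>N\<^esub> Y) = D \<star>\<^bsub>N\<^esub> Y"
    by (simp add: D_def einstein_prod_assoc)
  have DYA: "(D \<star>\<^bsub>N\<^esub> Y) \<star>\<^bsub>N\<^esub> A = A"
    using ADD core_inverse_inner[OF D Ycore] by (metis einstein_prod_assoc)
  obtain C where C: "A \<star>\<^bsub>N\<^esub> C = C \<star>\<^bsub>N\<^esub> A" "A = C \<star>\<^bsub>N\<^esub> (A \<star>\<^bsub>N\<^esub> A)"
    using square_divides_imp_commuting_inverse[OF A ind] by metis
  \<comment> \<open>\<open>A C B A\<close> is \<open>B D R\<close> with \<open>R = W C B A\<close>; its image under \<open>A\<close> is \<open>D (D R) = D A\<close>, so \<open>D R = A\<close>.\<close>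
  have "B \<star>\<^bsub>N\<^esub> A = A \<star>\<^bsub>N\<^esub> (C \<star>\<^bsub>N\<^esub> (B \<star>\<^bsub>N\<^esub> A))"
  proof -
    let ?R = "W \<star>\<^bsub>N\<^esub> (C \<star>\<^bsub>N\<^esub> (B \<star>\<^bsub>N\<^esub> A))"
    have "D \<star>\<^bsub>N\<^esub> (D \<star>\<^bsub>N\<^esub> ?R) = A \<star>\<^bsub>N\<^esub> (A \<star>\<^bsub>N\<^esub> (C \<star>\<^bsub>N\<^esub> (B \<star>\<^bsub>N\<^esub> A)))"
      using DDW by (metis einstein_prod_assoc)
    also have "\<dots> = D \<star>\<^bsub>N\<^esub> A"
      using C by (metis D_def einstein_prod_assoc)
    finally have "D \<star>\<^bsub>N\<^esub> ?R = Y \<star>\<^bsub>N\<^esub> (D \<star>\<^bsub>N\<^esub> A)"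
      using YD by metis
    also have "\<dots> = A"
      using ADD YD by metis
    finally show ?thesis
      using BDW by (metis einstein_prod_assoc)
  qed
  then have BA: "(D \<star>\<^bsub>N\<^esub> Y) \<star>\<^bsub>N\<^esub> (B \<star>\<^bsub>N\<^esub> A) = B \<star>\<^bsub>N\<^esub> A"
    using DYA by (metis einstein_prod_assoc)
  have "B \<star>\<^bsub>N\<^esub> Y = (B \<star>\<^bsub>N\<^esub> A) \<star>\<^bsub>N\<^esub> (B \<star>\<^bsub>N\<^esub> (Y \<star>\<^bsub>N\<^esub> Y))"
    using Y by (metis D_def einstein_prod_assoc)
  then have "A \<star>\<^bsub>N\<^esub> ((B \<star>\<^bsub>N\<^esub> Y) \<star>\<^bsub>N\<^esub> (B \<star>\<^bsub>N\<^esub> Y)) = B \<star>\<^bsub>N\<^esub> Y"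
    using BA AZ by (metis einstein_prod_assoc)
  moreover have "(B \<star>\<^bsub>N\<^esub> Y) \<star>\<^bsub>N\<^esub> (A \<star>\<^bsub>N\<^esub> A) = A"
    using DDW YD BDW by (metis einstein_prod_assoc)
  ultimately have "is_core_inverse N A (B \<star>\<^bsub>N\<^esub> Y)"
    using A AZ Y by (simp add: is_core_inverse_iff einstein_prod_in)
  then show thesis
    using that Ycore D_def by blast
qed

theorem theorem4p3:
  fixes N :: "nat list" and A B :: sq_tensor
  assumes "N \<noteq> []" and "\<forall>k<length N. 1 \<le> N ! k"
    and "A \<in> sq_tensors N" and "B \<in> sq_tensors N"
    and "tensor_index N A = 1"
  shows "(has_core_inverse N A \<and> has_core_inverse N (A \<star>\<^bsub>N\<^esub> B) \<and>
           core_inverse N A = B \<star>\<^bsub>N\<^esub> core_inverse N (A \<star>\<^bsub>N\<^esub> B))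
         \<longleftrightarrow> tensor_range N A \<subseteq> tensor_range N (B \<star>\<^bsub>N\<^esub> A \<star>\<^bsub>N\<^esub> B)"
proof
  note A = \<open>A \<in> sq_tensors N\<close> and AB = einstein_prod_in[of A N B]
  assume L: "has_core_inverse N A \<and> has_core_inverse N (A \<star>\<^bsub>N\<^esub> B) \<and>
    core_inverse N A = B \<star>\<^bsub>N\<^esub> core_inverse N (A \<star>\<^bsub>N\<^esub> B)"
  then obtain X Y where X: "is_core_inverse N A X" and Y: "is_core_inverse N (A \<star>\<^bsub>N\<^esub> B) Y"
    by (auto simp: has_core_inverse_def)
  have "X = B \<star>\<^bsub>N\<^esub> Y"
    using L core_inverse_eqI[OF A X] core_inverse_eqI[OF AB Y] by simp
  then have "A = B \<star>\<^bsub>N\<^esub> (Y \<star>\<^bsub>N\<^esub> (A \<star>\<^bsub>N\<^esub> A))"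
    using X by (simp add: is_core_inverse_iff[OF A] einstein_prod_assoc)
  moreover have "Y = A \<star>\<^bsub>N\<^esub> (B \<star>\<^bsub>N\<^esub> (Y \<star>\<^bsub>N\<^esub> Y))"
    using Y by (simp add: is_core_inverse_iff[OF AB] einstein_prod_assoc)
  ultimately have "A = (B \<star>\<^bsub>N\<^esub> A \<star>\<^bsub>N\<^esub> B) \<star>\<^bsub>N\<^esub> ((Y \<star>\<^bsub>N\<^esub> Y) \<star>\<^bsub>N\<^esub> (A \<star>\<^bsub>N\<^esub> A))"
    by (metis einstein_prod_assoc)
  then show "tensor_range N A \<subseteq> tensor_range N (B \<star>\<^bsub>N\<^esub> A \<star>\<^bsub>N\<^esub> B)"
    using tensor_range_subset_iff[OF A] by blast
next
  note A = \<open>A \<in> sq_tensors N\<close> and AB = einstein_prod_in[of A N B]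
  assume "tensor_range N A \<subseteq> tensor_range N (B \<star>\<^bsub>N\<^esub> A \<star>\<^bsub>N\<^esub> B)"
  then obtain W where W: "A = B \<star>\<^bsub>N\<^esub> (A \<star>\<^bsub>N\<^esub> (B \<star>\<^bsub>N\<^esub> W))"
    unfolding tensor_range_subset_iff[OF A] by (auto simp: einstein_prod_assoc)
  obtain V where "A = A \<star>\<^bsub>N\<^esub> (A \<star>\<^bsub>N\<^esub> V)"
    using index_1_factor[OF A \<open>tensor_index N A = 1\<close>] by blast
  then obtain Y where "is_core_inverse N (A \<star>\<^bsub>N\<^esub> B) Y" "is_core_inverse N A (B \<star>\<^bsub>N\<^esub> Y)"
    using core_inverse_of_factor[OF A _ W] by blast
  then show "has_core_inverse N A \<and> has_core_inverse N (A \<star>\<^bsub>N\<^esub> B) \<and>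
      core_inverse N A = B \<star>\<^bsub>N\<^esub> core_inverse N (A \<star>\<^bsub>N\<^esub> B)"
    using core_inverse_eqI[OF A] core_inverse_eqI[OF AB] by (auto simp: has_core_inverse_def)
qed

end
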